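(* Let $q\ge 2$ be an integer. If $\Lambda_q=\Gamma_q$, then for every integer $k$ with $\gcd(k,q)=1$, there exist integers $a,b$ with $b\ge 1$ and $\gcd(a,b)=1$ such that $S(a,b)=\frac{k}{q}$ if and only if both of the following conditions hold: - if $3\nmid q$, then $3\mid k$; - if $2\nmid q$, then $k\equiv 2\pmod 4$ when $q\equiv 3\pmod 4$; $k\equiv 0\pmod 8$ when $q$ is a square; and $k\equiv 0\pmod 4$ in all remaining cases.
   Context: For coprime integers $a,b$ with $b>0$, the Dedekind sum is $s(a,b)=\sum_{k=1}^{b}\left(\!\left(\frac{k}{b}\right)\!\right)\left(\!\left(\frac{ak}{b}\right)\!\right)$, where $((x))=\{x\}-\frac12$ if $x\in\mathbb{R}\setminus\mathbb{Z}$ (with $\{x\}$ the fractional part) and $((x))=0$ if $x\in\mathbb{Z}$. The normalized Dedekind sum is $S(a,b)=12\,s(a,b)$. For an integer $q\ge 2$, define $$\Lambda_q=\left\{\frac{(q^2-1)a}{t}-qS(aq,t)\pmod{q^2-1} : a,t\in\mathbb{Z},\ t>0,\ t\mid a^2+1,\ \gcd(aq,t)=1\right\}\subseteq \mathbb{Z}/(q^2-1)\mathbb{Z}$$ (the expressions $\frac{(q^2-1)a}{t}-qS(aq,t)$ are integers for such $a,t$), and define $\Gamma_q\subseteq\mathbb{Z}/(q^2-1)\mathbb{Z}$ by $\Gamma_q=\{24s : s\in\mathbb{Z}/(q^2-1)\mathbb{Z}\}$ if $q$ is a perfect square, and $\Gamma_q=\{12s : s\in\mathbb{Z}/(q^2-1)\mathbb{Z}\}$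 otherwise. *)

theory Defs
  imports "HOL-Number_Theory.Number_Theory" "HOL-Computational_Algebra.Nth_Powers"
begin

definition sawtooth :: "real \<Rightarrow> real" where
  "sawtooth x = (if x \<in> \<int> then 0 else frac x - 1 / 2)"

text \<open>Only meaningful for \<open>b > 0\<close> and coprime \<open>a\<close>, \<open>b\<close>; these conditions are imposed at
  each use.\<close>

definition dedekind_sum :: "int \<Rightarrow> int \<Rightarrow> real" where
  "dedekind_sum a b =
     (\<Sum>k = 1..b. sawtooth (of_int k / of_int b) * sawtooth (of_int (a * k) / of_int b))"

definition normalized_dedekind_sum :: "int \<Rightarrow> int \<Rightarrow> real" where
  "normalized_dedekind_sum a b = 12 * dedekind_sum a b"

text \<open>Elements of \<open>\<int>/(q\<^sup>2 - 1)\<int>\<close> are represented by their residues in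
  \<open>carrier (residue_ring (q\<^sup>2 - 1)) = {0..q\<^sup>2 - 2}\<close>. In the definition of \<open>Lambda_set\<close>, the integer
  \<open>n\<close> is the value of the real expression \<open>(q\<^sup>2 - 1) a / t - q S(a q, t)\<close>; this expression is always
  an integer under the stated conditions on \<open>a\<close> and \<open>t\<close>, since
  \<open>t S(c, t) \<equiv> c + c' (mod t)\<close> whenever \<open>c c' \<equiv> 1 (mod t)\<close>, so no pair \<open>(a, t)\<close> is lost.\<close>

definition Lambda_set :: "int \<Rightarrow> int set" where
  "Lambda_set q =
     {n mod (q\<^sup>2 - 1) | n a t. t > 0 \<and> t dvd a\<^sup>2 + 1 \<and> coprime (a * q) t \<and>
        real_of_int n = of_int ((q\<^sup>2 - 1) * a) / of_int t
                        - of_int q * normalized_dedekind_sum (a * q) t}"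

definition Gamma_set :: "int \<Rightarrow> int set" where
  "Gamma_set q =
     (if is_square q
      then {(24 * s) mod (q\<^sup>2 - 1) | s. s \<in> carrier (residue_ring (q\<^sup>2 - 1))}
      else {(12 * s) mod (q\<^sup>2 - 1) | s. s \<in> carrier (residue_ring (q\<^sup>2 - 1))})"

end

theory Submission
  imports Defs
begin

text \<open>If \<open>S(a, b) = k/q\<close> in lowest terms, then \<open>b = q t\<close> with \<open>t u = a\<^sup>2 + 1\<close> for some \<open>u\<close>, which is
  coprime to \<open>q\<close>. Dedekind's reciprocity law for \<open>(a, q t)\<close> combined with Rademacher's three-term law
  for \<open>(a, u, q)\<close> gives
  \<open>q S(a, q t) = ((q\<^sup>2 - 1) a / u - q S(a q, u)) + q S(r, q)\<close> with \<open>a \<equiv> u r (mod q)\<close>,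
  so \<open>k - q S(r, q)\<close> represents an element of \<open>\<Lambda>\<close>. Conversely, let \<open>r\<close> be inverse to \<open>k\<close> modulo \<open>q\<close>.
  If \<open>k - q S(r, q)\<close> represents an element of \<open>\<Lambda>\<close>, a suitable representative \<open>a\<close> modulo \<open>u\<close>
  realizes this integer exactly, and the congruence \<open>r \<cdot> q S(r, q) \<equiv> r\<^sup>2 + 1 (mod q)\<close> forces
  \<open>a \<equiv> u r (mod q)\<close>; hence \<open>k/q\<close> is a value.
  If \<open>\<Lambda> = \<Gamma>\<close>, it remains to know \<open>q S(r, q)\<close> modulo 3 (for \<open>q\<close> prime to 3), modulo 4 (for odd \<open>q\<close>)
  and modulo 8 (for odd squares \<open>q\<close>).\<close>

section \<open>Sums of sawtooth values\<close>

definition saw :: "int \<Rightarrow> int \<Rightarrow> real" where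
  "saw n m = sawtooth (of_int m / of_int n)"

text \<open>Rademacher's three-variable sum. For \<open>c\<close> coprime to \<open>a\<close> it is
  the Dedekind sum of b/c taken modulo \<open>a\<close>; this form avoids choosing inverses and
  makes the three-term law cyclically symmetric.\<close>

definition dedekind_sum3 :: "int \<Rightarrow> int \<Rightarrow> int \<Rightarrow> real" where
  "dedekind_sum3 a b c = (\<Sum>x\<in>{0..<a}. saw a (b * x) * saw a (c * x))"

lemma saw_eq:
  assumes "n > 0"
  shows "saw n m = (if n dvd m then 0 else of_int (m mod n) / of_int n - 1 / 2)"
proof -
  have dvd: "(of_int m / of_int n :: real) \<in> \<int> \<longleftrightarrow> n dvd m"
    using assms of_int_div_of_int_in_Ints_iff[of m n, where 'a = real] by auto
  have "frac (of_int m / of_int n :: real) = of_int (m mod n) / of_int n"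
  proof -
    have "\<lfloor>of_int m / of_int n :: real\<rfloor> = m div n"
      by (simp add: floor_divide_of_int_eq)
    moreover have "of_int m = (of_int (m div n) * of_int n + of_int (m mod n) :: real)"
      by (metis div_mult_mod_eq of_int_add of_int_mult)
    ultimately show ?thesis
      using assms by (simp add: frac_def field_simps)
  qed
  then show ?thesis
    by (simp add: saw_def sawtooth_def dvd)
qed

lemma saw_cong: "n > 0 \<Longrightarrow> [m = m'] (mod n) \<Longrightarrow> saw n m = saw n m'"
  by (simp add: saw_eq cong_def dvd_eq_mod_eq_0)

lemma saw_minus:
  assumes "n > 0"
  shows "saw n (- m) = - saw n m"
  using assms by (auto simp: saw_eq zmod_zminus1_eq_if field_simps dest: mod_0_imp_dvd)

lemma saw_scale: "c \<noteq> 0 \<Longrightarrow> saw (c * n) (c * m) = saw n m"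
  by (simp add: saw_def)

lemma saw_dvd: "n dvd m \<Longrightarrow> saw n m = 0"
  by (auto simp: saw_def sawtooth_def elim!: dvdE split: if_splits)

section \<open>Sums over complete residue systems and in blocks\<close>

lemma sum_mod_affine:
  fixes F :: "int \<Rightarrow> 'a :: comm_monoid_add"
  assumes "n > 0" "coprime b n" and per: "\<And>x y. [x = y] (mod n) \<Longrightarrow> F x = F y"
  shows "(\<Sum>j\<in>{0..<n}. F (b * j + i)) = (\<Sum>j\<in>{0..<n}. F j)"
proof -
  let ?h = "\<lambda>j. (b * j + i) mod n"
  have inj: "inj_on ?h {0..<n}"
  proof
    fix x y assume xy: "x \<in> {0..<n}" "y \<in> {0..<n}" "?h x = ?h y"
    then have "[b * x = b * y] (mod n)"
      by (metis cong_add_rcancel cong_def)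
    then have "[x = y] (mod n)"
      using assms(2) by (simp add: cong_mult_lcancel)
    with xy show "x = y" by (simp add: cong_def)
  qed
  have "?h ` {0..<n} \<subseteq> {0..<n}" using assms(1) by auto
  then have "?h ` {0..<n} = {0..<n}"
    using inj by (simp add: endo_inj_surj)
  then have "(\<Sum>j\<in>{0..<n}. F j) = (\<Sum>j\<in>{0..<n}. F (?h j))"
    using inj by (metis (no_types, lifting) sum.reindex_cong)
  also have "\<dots> = (\<Sum>j\<in>{0..<n}. F (b * j + i))"
    by (intro sum.cong refl per) (simp add: cong_def)
  finally show ?thesis by simp
qed

lemma sum_blocks:
  fixes F :: "int \<Rightarrow> 'a :: comm_monoid_add"
  assumes "n > 0" "c > 0"
  shows "(\<Sum>m\<in>{0..<n * c}. F m) = (\<Sum>r\<in>{0..<n}. \<Sum>j\<in>{0..<c}. F (r + n * j))"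
proof -
  have "(\<Sum>r\<in>{0..<n}. \<Sum>j\<in>{0..<c}. F (r + n * j))
      = (\<Sum>(r, j)\<in>{0..<n} \<times> {0..<c}. F (r + n * j))"
    by (simp add: sum.cartesian_product)
  also have "\<dots> = (\<Sum>m\<in>{0..<n * c}. F m)"
  proof (rule sum.reindex_bij_witness[where i = "\<lambda>m. (m mod n, m div n)" and j = "\<lambda>(r, j). r + n * j"])
    fix p assume "p \<in> {0..<n} \<times> {0..<c}"
    then obtain r j where p: "p = (r, j)" "0 \<le> r" "r < n" "0 \<le> j" "j < c" by auto
    have "n * j \<le> n * (c - 1)" using p assms by (intro mult_left_mono) auto
    then show "(case p of (r, j) \<Rightarrow> r + n * j) \<in> {0..<n * c}"
      using p assms by (auto simp: algebra_simps)
  next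
    fix m assume m: "m \<in> {0..<n * c}"
    have "n * (m div n) \<le> m"
      using mult_div_mod_eq[of n m] pos_mod_sign[OF assms(1), of m] by linarith
    with m have "n * (m div n) < n * c" by simp
    then have "m div n < c"
      using assms by (simp add: mult_less_cancel_left_pos)
    then show "(m mod n, m div n) \<in> {0..<n} \<times> {0..<c}"
      using m assms by (auto simp: pos_imp_zdiv_nonneg_iff)
  qed (use assms in auto)
  finally show ?thesis by simp
qed

lemma sum_dvd_indicator:
  fixes F :: "int \<Rightarrow> real"
  assumes "n > 0" "c > 0"
  shows "(\<Sum>m\<in>{0..<n * c}. of_bool (n dvd m) * F m) = (\<Sum>j\<in>{0..<c}. F (n * j))"
proof -
  have "(\<Sum>m\<in>{0..<n * c}. of_bool (n dvd m) * F m)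
      = (\<Sum>r\<in>{0..<n}. if r = 0 then \<Sum>j\<in>{0..<c}. F (n * j) else 0)"
    unfolding sum_blocks[OF assms]
  proof (intro sum.cong refl)
    fix r assume "r \<in> {0..<n}"
    then have "n dvd r \<longleftrightarrow> r = 0" using zdvd_not_zless[of r n] by force
    then show "(\<Sum>j\<in>{0..<c}. of_bool (n dvd r + n * j) * F (r + n * j)) =
      (if r = 0 then \<Sum>j\<in>{0..<c}. F (n * j) else 0)"
      by (simp add: dvd_add_left_iff)
  qed
  then show ?thesis using assms by simp
qed

lemma sum_of_int_upto:
  assumes "n \<ge> (0::int)"
  shows "(\<Sum>j\<in>{0..<n}. of_int j) = (of_int n * (of_int n - 1) / 2 :: real)"
  using assms
proof (induction n rule: int_ge_induct)
  case (step i)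
  have "{0..<i + 1} = insert i {0..<i}" using step by auto
  then show ?case using step by (simp add: field_simps)
qed simp

lemma sum_of_int_squares_upto:
  assumes "n \<ge> (0::int)"
  shows "(\<Sum>j\<in>{0..<n}. (of_int j)\<^sup>2) = (of_int n * (of_int n - 1) * (2 * of_int n - 1) / 6 :: real)"
  using assms
proof (induction n rule: int_ge_induct)
  case (step i)
  have "{0..<i + 1} = insert i {0..<i}" using step by auto
  then show ?case using step by (simp add: field_simps power2_eq_square)
qed simp

lemma int_upto_insert0: "n > (0::int) \<Longrightarrow> {0..<n} = insert 0 {1..<n}"
  by auto

text \<open>The distribution relation of the sawtooth: its values at the \<open>c\<close> translates
  of x = r/(ac) by multiples of 1/c add up to its value at c x. The quotient of \<open>r\<close> by
  \<open>a\<close> is absorbed in a shift of \<open>j\<close>, after which every argument lies in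
  [0, 1).\<close>

lemma sum_saw_distribution:
  assumes "a > 0" "c > 0"
  shows "(\<Sum>j\<in>{0..<c}. saw (a * c) (r + a * j)) = saw a r"
proof -
  define r0 where "r0 = r mod a"
  have r: "r = r0 + a * (r div a)" by (simp add: r0_def)
  have r0: "0 \<le> r0" "r0 < a" using assms by (auto simp: r0_def)
  have bound: "r0 + a * j < a * c" "0 \<le> r0 + a * j" if "j \<in> {0..<c}" for j
  proof -
    have "a * j \<le> a * (c - 1)" using that assms by (intro mult_left_mono) auto
    then show "r0 + a * j < a * c" using r0 by (simp add: algebra_simps)
    show "0 \<le> r0 + a * j" using that assms r0 by simp
  qed
  have saw0: "saw (a * c) (r0 + a * j) =
      (if r0 + a * j = 0 then 0 else of_int (r0 + a * j) / of_int (a * c) - 1 / 2)"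
    if "j \<in> {0..<c}" for j
  proof -
    have "a * c dvd r0 + a * j \<longleftrightarrow> r0 + a * j = 0"
      using bound[OF that] zdvd_not_zless[of "r0 + a * j" "a * c"] by force
    then show ?thesis using bound[OF that] assms by (simp add: saw_eq)
  qed
  have "(\<Sum>j\<in>{0..<c}. saw (a * c) (r + a * j))
      = (\<Sum>j\<in>{0..<c}. saw (a * c) (r0 + a * (1 * j + r div a)))"
    by (subst r) (simp add: algebra_simps)
  also have "\<dots> = (\<Sum>j\<in>{0..<c}. saw (a * c) (r0 + a * j))"
  proof (rule sum_mod_affine)
    fix x y assume "[x = y] (mod c)"
    then have "[r0 + a * x = r0 + a * y] (mod a * c)"
      by (intro cong_add cong_refl) (simp add: cong_iff_dvd_diff flip: right_diff_distrib)
    then show "saw (a * c) (r0 + a * x) = saw (a * c) (r0 + a * y)"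
      using assms by (intro saw_cong) auto
  qed (use assms in auto)
  also have "\<dots> = saw a r0"
  proof (cases "r0 = 0")
    case True
    have "(\<Sum>j\<in>{0..<c}. saw (a * c) (r0 + a * j)) = (\<Sum>j\<in>{1..<c}. saw (a * c) (r0 + a * j))"
      using assms True by (simp add: int_upto_insert0 saw_dvd)
    also have "\<dots> = (\<Sum>j\<in>{1..<c}. of_int j / of_int c - 1 / 2)"
      using assms True by (intro sum.cong refl) (subst saw0, auto)
    \<comment> \<open>Index 0 would contribute -1/2 to the linear formula, whereas the sawtooth
      vanishes there.\<close>
    also have "\<dots> = (\<Sum>j\<in>{0..<c}. of_int j / of_int c - 1 / 2) + 1 / 2"
      using assms by (simp add: int_upto_insert0)
    also have "\<dots> = 0"
      using assms by (simp add: sum_subtractf sum_of_int_upto flip: sum_divide_distrib) (simp add: field_simps)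
    finally show ?thesis using True by (simp add: saw_dvd)
  next
    case False
    have "(\<Sum>j\<in>{0..<c}. saw (a * c) (r0 + a * j))
        = (\<Sum>j\<in>{0..<c}. of_int r0 / of_int (a * c) - 1 / 2 + of_int j / of_int c)"
    proof (intro sum.cong refl)
      fix j assume j: "j \<in> {0..<c}"
      have "a * j \<ge> 0" using j assms by simp
      then have "r0 + a * j \<noteq> 0" using r0 False by linarith
      then show "saw (a * c) (r0 + a * j)
          = of_int r0 / of_int (a * c) - 1 / 2 + of_int j / of_int c"
        using assms by (simp add: saw0[OF j] field_simps)
    qed
    also have "\<dots> = of_int r0 / of_int a - 1 / 2"
      using assms by (simp add: sum.distrib sum_of_int_upto flip: sum_divide_distrib) (simp add: field_simps)
    also have "\<dots> = saw a r0"
      using False r0 assms zdvd_not_zless[of r0 a] by (force simp: saw_eq)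
    finally show ?thesis .
  qed
  also have "\<dots> = saw a r"
    using assms by (intro saw_cong) (auto simp: r0_def cong_def)
  finally show ?thesis .
qed

lemma sum_saw_squared:
  assumes "a > 0"
  shows "(\<Sum>r\<in>{0..<a}. (saw a r)\<^sup>2) = (of_int a - 1) * (of_int a - 2) / (12 * of_int a)"
proof -
  have "(\<Sum>r\<in>{0..<a}. (saw a r)\<^sup>2) = (\<Sum>r\<in>{1..<a}. (saw a r)\<^sup>2)"
    using assms by (simp add: int_upto_insert0 saw_dvd)
  also have "\<dots> = (\<Sum>r\<in>{1..<a}. (of_int r / of_int a - 1 / 2)\<^sup>2)"
    using assms zdvd_not_zless[of _ a] by (intro sum.cong refl) (force simp: saw_eq)
  also have "\<dots> = (\<Sum>r\<in>{0..<a}. (of_int r / of_int a - 1 / 2)\<^sup>2) - 1 / 4"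
    using assms by (simp add: int_upto_insert0 power2_eq_square)
  also have "(\<Sum>r\<in>{0..<a}. (of_int r / of_int a - 1 / 2 :: real)\<^sup>2)
      = (\<Sum>r\<in>{0..<a}. (of_int r)\<^sup>2) / (of_int a)\<^sup>2 - (\<Sum>r\<in>{0..<a}. of_int r) / of_int a + of_int a / 4"
  proof -
    have "(of_int r / of_int a - 1 / 2 :: real)\<^sup>2
        = (of_int r)\<^sup>2 / (of_int a)\<^sup>2 - of_int r / of_int a + 1 / 4" for r
      using assms by (simp add: field_simps power2_eq_square)
    then show ?thesis
      using assms by (simp add: sum.distrib sum_subtractf sum_divide_distrib)
  qed
  finally show ?thesis
    using assms by (simp add: sum_of_int_upto sum_of_int_squares_upto) (simp add: field_simps power2_eq_square)
qed

text \<open>Two applications of the distribution relation. Blocks of length \<open>a * b\<close> fix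
  the second factor and sum the first over \<open>c\<close> translates, since \<open>b\<close>
  permutes the residues modulo \<open>c\<close>; blocks of length \<open>a\<close> then leave the
  squares of \<open>saw a r\<close>.\<close>

lemma sum_saw_mult_saw:
  assumes "a > 0" "b > 0" "c > 0" "coprime b c"
  shows "(\<Sum>m\<in>{0..<a * b * c}. saw (a * c) m * saw (a * b) m)
       = (of_int a - 1) * (of_int a - 2) / (12 * of_int a)"
proof -
  have "(\<Sum>m\<in>{0..<a * b * c}. saw (a * c) m * saw (a * b) m)
      = (\<Sum>r\<in>{0..<a * b}. \<Sum>j\<in>{0..<c}. saw (a * c) (r + a * b * j) * saw (a * b) (r + a * b * j))"
    using assms by (intro sum_blocks) auto
  also have "\<dots> = (\<Sum>r\<in>{0..<a * b}. saw (a * b) r * saw a r)"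
  proof (intro sum.cong refl)
    fix r
    have "(\<Sum>j\<in>{0..<c}. saw (a * c) (r + a * b * j) * saw (a * b) (r + a * b * j))
        = saw (a * b) r * (\<Sum>j\<in>{0..<c}. saw (a * c) (r + a * (b * j + 0)))"
      unfolding sum_distrib_left
    proof (intro sum.cong refl)
      fix j
      have "saw (a * b) (r + a * b * j) = saw (a * b) r"
        using assms by (intro saw_cong) (auto simp: cong_def)
      then show "saw (a * c) (r + a * b * j) * saw (a * b) (r + a * b * j)
          = saw (a * b) r * saw (a * c) (r + a * (b * j + 0))"
        by (simp add: mult_ac)
    qed
    also have "(\<Sum>j\<in>{0..<c}. saw (a * c) (r + a * (b * j + 0))) = (\<Sum>j\<in>{0..<c}. saw (a * c) (r + a * j))"
    proof (rule sum_mod_affine)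
      fix x y assume "[x = y] (mod c)"
      then have "[r + a * x = r + a * y] (mod a * c)"
        by (intro cong_add cong_refl) (simp add: cong_iff_dvd_diff flip: right_diff_distrib)
      then show "saw (a * c) (r + a * x) = saw (a * c) (r + a * y)"
        using assms by (intro saw_cong) auto
    qed (use assms in auto)
    finally show "(\<Sum>j\<in>{0..<c}. saw (a * c) (r + a * b * j) * saw (a * b) (r + a * b * j))
        = saw (a * b) r * saw a r"
      using assms by (simp add: sum_saw_distribution)
  qed
  also have "\<dots> = (\<Sum>r\<in>{0..<a}. \<Sum>j\<in>{0..<b}. saw (a * b) (r + a * j) * saw a (r + a * j))"
    using assms by (intro sum_blocks) auto
  also have "\<dots> = (\<Sum>r\<in>{0..<a}. (saw a r)\<^sup>2)"
  proof (intro sum.cong refl)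
    fix r
    have "saw a (r + a * j) = saw a r" for j
      using assms by (intro saw_cong) (auto simp: cong_def)
    then have "(\<Sum>j\<in>{0..<b}. saw (a * b) (r + a * j) * saw a (r + a * j))
        = (\<Sum>j\<in>{0..<b}. saw (a * b) (r + a * j)) * saw a r"
      by (simp add: sum_distrib_right)
    then show "(\<Sum>j\<in>{0..<b}. saw (a * b) (r + a * j) * saw a (r + a * j)) = (saw a r)\<^sup>2"
      using assms by (simp add: sum_saw_distribution power2_eq_square)
  qed
  finally show ?thesis using assms by (simp add: sum_saw_squared)
qed

section \<open>Reciprocity\<close>

text \<open>The value of the sawtooth function at \<open>(m + 1/2) / n\<close>.\<close>
definition saw_half :: "int \<Rightarrow> int \<Rightarrow> real" where
  "saw_half n m = (of_int (m mod n) + 1 / 2) / of_int n - 1 / 2"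

text \<open>At half-integers the exceptional value 0 never occurs, and \<open>saw n m\<close> is the
  mean of the values half a step to either side. The increment across \<open>m\<close> is 1/n, less
  1 when \<open>n\<close> divides \<open>m\<close>.\<close>

lemma saw_half_step:
  assumes "n > 0"
  shows "saw_half n m = saw n m + (1 / of_int n - of_bool (n dvd m)) / 2"
    and "saw_half n (m - 1) = saw n m - (1 / of_int n - of_bool (n dvd m)) / 2"
proof -
  show "saw_half n m = saw n m + (1 / of_int n - of_bool (n dvd m)) / 2"
    using assms by (auto simp: saw_half_def saw_eq field_simps)
  have "(m - 1) mod n = (if n dvd m then n - 1 else m mod n - 1)"
  proof (cases "n dvd m")
    case True
    then have "(m - 1) mod n = (-1) mod n"
      by (metis mod_0_imp_dvd dvd_imp_mod_0 diff_0 mod_diff_left_eq)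
    then show ?thesis using True assms by (simp add: zmod_minus1)
  next
    case False
    then have "m mod n \<noteq> 0" by (simp add: dvd_eq_mod_eq_0)
    moreover have "0 \<le> m mod n" "m mod n < n" using assms by auto
    ultimately have "(m mod n - 1) mod n = m mod n - 1"
      by (intro mod_pos_pos_trivial) linarith+
    then show ?thesis using False by (simp add: mod_diff_left_eq)
  qed
  then show "saw_half n (m - 1) = saw n m - (1 / of_int n - of_bool (n dvd m)) / 2"
    using assms by (auto simp: saw_half_def saw_eq field_simps)
qed

text \<open>Reversing all three increments cancels the terms of even degree in them.\<close>

lemma product_difference:
  fixes x y z d e g :: real
  shows "(x + d / 2) * (y + e / 2) * (z + g / 2) - (x - d / 2) * (y - e / 2) * (z - g / 2)
    = d * (y * z) + e * (z * x) + g * (x * y) + d * e * g / 4"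
  by (simp add: field_simps)

lemma product_of_differences:
  fixes x y z d e g :: real
  shows "(x - d) * (y - e) * (z - g)
    = x * y * z - d * (y * z) - e * (x * z) - g * (x * y) + d * e * z + e * g * x + d * g * y - d * e * g"
  by (simp add: algebra_simps)

text \<open>\<open>a\<close> divides \<open>m\<close> through \<open>c * a\<close> and is coprime to
  \<open>b * c\<close>. Hence the discontinuities of any two factors in the three-term law meet only
  at multiples of \<open>a * b * c\<close>.\<close>

lemma coprime_dvd_mult_all:
  fixes a b c m :: int
  assumes "coprime a b" "coprime b c" "coprime c a"
  shows "b * c dvd m \<and> c * a dvd m \<longleftrightarrow> a * b * c dvd m"
proof
  assume *: "b * c dvd m \<and> c * a dvd m"
  then have "b * c dvd m" "a dvd m" by (auto dest: dvd_mult_right)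
  moreover have "coprime a (b * c)" using assms by (simp add: coprime_commute)
  ultimately show "a * b * c dvd m" by (metis divides_mult mult.assoc)
qed (auto simp: mult_ac intro: dvd_trans[of _ "a * b * c"])

text \<open>For \<open>N = abc\<close>, the sum of the differences
  \<open>F(m) - F(m-1)\<close> over all residues \<open>m\<close> modulo \<open>N\<close> vanishes, where \<open>F(m)\<close> is the product of the
  three sawtooth values at \<open>(m + 1/2)/(bc)\<close>, \<open>(m + 1/2)/(ca)\<close> and \<open>(m + 1/2)/(ab)\<close>. The jumps of
  the factors give the Dedekind sums.\<close>

theorem dedekind_sum3_reciprocity:
  assumes pos: "a > 0" "b > 0" "c > 0"
    and cop: "coprime a b" "coprime b c" "coprime c a"
  shows "dedekind_sum3 a b c + dedekind_sum3 b c a + dedekind_sum3 c a b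
       = - 1 / 4 + ((of_int a)\<^sup>2 + (of_int b)\<^sup>2 + (of_int c)\<^sup>2) / (12 * of_int (a * b * c))"
proof -
  define N where "N = a * b * c"
  have N: "N > 0" using pos by (simp add: N_def)
  define A B C where "A = b * c" and "B = c * a" and "C = a * b"
  note ABC = A_def B_def C_def
  have ABC_pos: "A > 0" "B > 0" "C > 0" using pos by (auto simp: ABC)
  have NA: "N = A * a" "N = B * b" "N = C * c" by (auto simp: N_def ABC)
  define jump where "jump n m = (1 / of_int n - of_bool (n dvd m) :: real)" for n m :: int
  define F where "F m = saw_half A m * saw_half B m * saw_half C m" for m
  have F_cong: "F x = F y" if "[x = y] (mod N)" for x y
  proof -
    have "[x = y] (mod A)" "[x = y] (mod B)" "[x = y] (mod C)"
      using that NA by (metis cong_modulus_mult)+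
    then show ?thesis by (simp add: F_def saw_half_def cong_def)
  qed
  \<comment> \<open>Translation by -1 permutes the residues modulo \<open>N\<close>, so the
    differences sum to zero.\<close>
  have "(\<Sum>m\<in>{0..<N}. F (1 * m + (- 1))) = (\<Sum>m\<in>{0..<N}. F m)"
    using N F_cong by (intro sum_mod_affine) auto
  then have "0 = (\<Sum>m\<in>{0..<N}. F m - F (m - 1))"
    by (simp add: sum_subtractf)
  also have "\<dots> = (\<Sum>m\<in>{0..<N}. jump A m * (saw B m * saw C m)
      + jump B m * (saw C m * saw A m) + jump C m * (saw A m * saw B m)
      + jump A m * jump B m * jump C m / 4)"
  proof (intro sum.cong refl)
    fix m
    have "saw_half n m = saw n m + jump n m / 2 \<and> saw_half n (m - 1) = saw n m - jump n m / 2"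
      if "n > 0" for n
      using saw_half_step[OF that] by (simp add: jump_def)
    then show "F m - F (m - 1) = jump A m * (saw B m * saw C m)
        + jump B m * (saw C m * saw A m) + jump C m * (saw A m * saw B m)
        + jump A m * jump B m * jump C m / 4"
      using ABC_pos unfolding F_def by (simp only: product_difference simp_thms)
  qed
  also have "\<dots> = (\<Sum>m\<in>{0..<N}. jump A m * (saw B m * saw C m))
      + (\<Sum>m\<in>{0..<N}. jump B m * (saw C m * saw A m))
      + (\<Sum>m\<in>{0..<N}. jump C m * (saw A m * saw B m))
      + (\<Sum>m\<in>{0..<N}. jump A m * jump B m * jump C m) / 4"
    by (simp add: sum.distrib sum_divide_distrib)
  finally have total: "0 = \<dots>" .
  \<comment> \<open>The constant part of the jump leads to the mean of a product of two sawtooths.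
    The indicator selects the multiples of \<open>v * w\<close>, where both factors become sawtooths
    modulo \<open>u\<close>.\<close>
  have jump_sum: "(\<Sum>m\<in>{0..<u * v * w}. jump (v * w) m * (saw (w * u) m * saw (u * v) m))
      = (of_int u - 1) * (of_int u - 2) / (12 * of_int (u * v * w)) - dedekind_sum3 u v w"
    if "u > 0" "v > 0" "w > 0" "coprime v w" for u v w :: int
  proof -
    have 1: "(\<Sum>m\<in>{0..<u * v * w}. saw (w * u) m * saw (u * v) m) / of_int (v * w)
        = (of_int u - 1) * (of_int u - 2) / (12 * of_int (u * v * w))"
      using sum_saw_mult_saw[OF that] that by (simp add: mult_ac)
    have "(\<Sum>m\<in>{0..<u * v * w}. of_bool (v * w dvd m) * (saw (w * u) m * saw (u * v) m))
        = (\<Sum>m\<in>{0..<v * w * u}. of_bool (v * w dvd m) * (saw (w * u) m * saw (u * v) m))"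
      by (simp add: mult_ac)
    also have "\<dots> = (\<Sum>j\<in>{0..<u}. saw (w * u) (v * w * j) * saw (u * v) (v * w * j))"
      using that by (intro sum_dvd_indicator) auto
    also have "\<dots> = dedekind_sum3 u v w"
      unfolding dedekind_sum3_def
    proof (intro sum.cong refl)
      fix j
      have "saw (w * u) (v * w * j) = saw u (v * j)" "saw (u * v) (v * w * j) = saw u (w * j)"
        using that saw_scale[of w u "v * j"] saw_scale[of v u "w * j"] by (simp_all add: mult_ac)
      then show "saw (w * u) (v * w * j) * saw (u * v) (v * w * j) = saw u (v * j) * saw u (w * j)"
        by simp
    qed
    finally have 2: "(\<Sum>m\<in>{0..<u * v * w}. of_bool (v * w dvd m) * (saw (w * u) m * saw (u * v) m))
        = dedekind_sum3 u v w" .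
    have "jump (v * w) m * (saw (w * u) m * saw (u * v) m)
        = saw (w * u) m * saw (u * v) m / of_int (v * w)
          - of_bool (v * w dvd m) * (saw (w * u) m * saw (u * v) m)" for m
      by (simp only: jump_def left_diff_distrib) simp
    then show ?thesis
      by (simp only: sum_subtractf 2 1 flip: sum_divide_distrib)
  qed
  have triple: "(\<Sum>m\<in>{0..<N}. jump A m * jump B m * jump C m)
      = (of_int (a + b + c) - 2) / of_int N - 1"
  proof -
    have one: "(\<Sum>m\<in>{0..<N}. of_bool (N dvd m) :: real) = 1"
      using sum_dvd_indicator[of N 1 "\<lambda>_. 1"] N by simp
    have ind: "(\<Sum>m\<in>{0..<N}. of_bool (A dvd m) :: real) = of_int a"
      "(\<Sum>m\<in>{0..<N}. of_bool (B dvd m) :: real) = of_int b"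
      "(\<Sum>m\<in>{0..<N}. of_bool (C dvd m) :: real) = of_int c"
      using sum_dvd_indicator[OF ABC_pos(1) pos(1), of "\<lambda>_. 1"]
        sum_dvd_indicator[OF ABC_pos(2) pos(2), of "\<lambda>_. 1"]
        sum_dvd_indicator[OF ABC_pos(3) pos(3), of "\<lambda>_. 1"] pos NA by simp_all
    \<comment> \<open>Any two of the divisibilities give divisibility by \<open>N\<close>, so all
      products of distinct indicators collapse to that of \<open>N\<close>.\<close>
    have both: "A dvd m \<and> B dvd m \<longleftrightarrow> N dvd m" "B dvd m \<and> C dvd m \<longleftrightarrow> N dvd m"
      "A dvd m \<and> C dvd m \<longleftrightarrow> N dvd m" for m
      using coprime_dvd_mult_all[OF cop, of m] coprime_dvd_mult_all[OF cop(2,3,1), of m]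
        coprime_dvd_mult_all[OF cop(3,1,2), of m]
      by (auto simp: ABC N_def mult_ac)
    have "jump A m * jump B m * jump C m
        = 1 / of_int (A * B * C) - of_bool (A dvd m) / of_int (B * C)
          - of_bool (B dvd m) / of_int (A * C) - of_bool (C dvd m) / of_int (A * B)
          + of_bool (N dvd m) * (1 / of_int A + 1 / of_int B + 1 / of_int C - 1)" for m
    proof -
      have "of_bool (A dvd m) * of_bool (B dvd m) = (of_bool (N dvd m) :: real)"
        "of_bool (B dvd m) * of_bool (C dvd m) = (of_bool (N dvd m) :: real)"
        "of_bool (A dvd m) * of_bool (C dvd m) = (of_bool (N dvd m) :: real)"
        "of_bool (N dvd m) * of_bool (C dvd m) = (of_bool (N dvd m) :: real)"
        using both[of m] by (auto simp flip: of_bool_conj)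
      then have "(of_bool (A dvd m) :: real) * of_bool (B dvd m) * of_bool (C dvd m) = of_bool (N dvd m)"
        "(of_bool (A dvd m) :: real) * of_bool (B dvd m) = of_bool (N dvd m)"
        "(of_bool (B dvd m) :: real) * of_bool (C dvd m) = of_bool (N dvd m)"
        "(of_bool (A dvd m) :: real) * of_bool (C dvd m) = of_bool (N dvd m)"
        by simp_all
      then show ?thesis
        unfolding jump_def of_int_mult
        using product_of_differences[of "1 / of_int A" "of_bool (A dvd m)" "1 / of_int B"
            "of_bool (B dvd m)" "1 / of_int C" "of_bool (C dvd m)"]
        by (simp add: algebra_simps)
    qed
    then have "(\<Sum>m\<in>{0..<N}. jump A m * jump B m * jump C m)
        = of_int N / of_int (A * B * C) - of_int a / of_int (B * C)
          - of_int b / of_int (A * C) - of_int c / of_int (A * B)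
          + (1 / of_int A + 1 / of_int B + 1 / of_int C - 1)"
      using N by (simp add: sum.distrib sum_subtractf one ind flip: sum_divide_distrib sum_distrib_right)
    also have "\<dots> = (of_int (a + b + c) - 2) / of_int N - 1"
      using pos unfolding ABC N_def by (simp add: field_simps)
    finally show ?thesis .
  qed
  have "0 = (of_int a - 1) * (of_int a - 2) / (12 * of_int N) - dedekind_sum3 a b c
      + ((of_int b - 1) * (of_int b - 2) / (12 * of_int N) - dedekind_sum3 b c a)
      + ((of_int c - 1) * (of_int c - 2) / (12 * of_int N) - dedekind_sum3 c a b)
      + ((of_int (a + b + c) - 2) / of_int N - 1) / 4"
    using total jump_sum[of a b c] jump_sum[of b c a] jump_sum[of c a b] triple pos cop
    by (simp add: ABC N_def mult_ac)
  \<comment> \<open>Over 12 N, the quadratics contribute -3(a + b + c) + 6 beyond the squares, and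
    the triple product contributes 3(a + b + c) - 6; these cancel.\<close>
  moreover have "(of_int a - 1) * (of_int a - 2) / (12 * of_int N)
      + (of_int b - 1) * (of_int b - 2) / (12 * of_int N)
      + (of_int c - 1) * (of_int c - 2) / (12 * of_int N) + (of_int (a + b + c) - 2) / of_int N / 4
      = ((of_int a)\<^sup>2 + (of_int b)\<^sup>2 + (of_int c)\<^sup>2) / (12 * of_int N :: real)"
    using N by (simp add: field_simps power2_eq_square)
  ultimately show ?thesis
    unfolding N_def[symmetric] by (simp add: diff_divide_distrib)
qed

section \<open>Classical Dedekind sums and the two-term law\<close>

abbreviation (input) S :: "int \<Rightarrow> int \<Rightarrow> real" where
  "S \<equiv> normalized_dedekind_sum"

lemma dedekind_sum_eq:
  assumes "b > 0"
  shows "dedekind_sum a b = (\<Sum>k\<in>{0..<b}. saw b k * saw b (a * k))"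
proof -
  \<comment> \<open>The terms at the endpoints \<open>b\<close> and 0 both vanish, so one may
    replace the other.\<close>
  have "{1..b} = insert b {1..<b}" using assms by auto
  then show ?thesis
    using assms saw_dvd[of b b]
    by (simp add: dedekind_sum_def int_upto_insert0 saw_dvd flip: saw_def of_int_mult)
qed

text \<open>Here \<open>y\<close> is b/c modulo \<open>a\<close>: as c x runs through all residues,
  b x is \<open>y\<close> times it.\<close>

lemma dedekind_sum3_eq:
  assumes "a > 0" "coprime c a" "[b = c * y] (mod a)"
  shows "dedekind_sum3 a b c = dedekind_sum y a"
proof -
  have "dedekind_sum3 a b c = (\<Sum>x\<in>{0..<a}. saw a (c * x + 0) * saw a (y * (c * x + 0)))"
    unfolding dedekind_sum3_def
  proof (intro sum.cong refl)
    fix x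
    have "[b * x = y * (c * x + 0)] (mod a)"
      using cong_scalar_right[OF assms(3), of x] by (simp add: mult_ac)
    then show "saw a (b * x) * saw a (c * x) = saw a (c * x + 0) * saw a (y * (c * x + 0))"
      using saw_cong[OF assms(1)] by (simp add: mult.commute)
  qed
  also have "\<dots> = (\<Sum>x\<in>{0..<a}. saw a x * saw a (y * x))"
    using assms saw_cong[OF assms(1)] by (intro sum_mod_affine) (auto simp: cong_scalar_left)
  finally show ?thesis using assms by (simp add: dedekind_sum_eq)
qed

lemma dedekind_sum3_commute: "dedekind_sum3 a b c = dedekind_sum3 a c b"
  by (simp add: dedekind_sum3_def mult.commute)

lemma normalized_dedekind_sum_cong:
  assumes "b > 0" "[a = a'] (mod b)"
  shows "S a b = S a' b"
proof -
  have "saw b (a * k) = saw b (a' * k)" for k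
    using assms by (intro saw_cong cong_scalar_right)
  then show ?thesis
    using assms by (simp add: normalized_dedekind_sum_def dedekind_sum_eq)
qed

lemma normalized_dedekind_sum_minus: "b > 0 \<Longrightarrow> S (- a) b = - S a b"
  by (simp add: normalized_dedekind_sum_def dedekind_sum_eq saw_minus sum_negf)

text \<open>The case c = 1 of the three-term law, where the term of modulus 1 vanishes.\<close>

theorem normalized_dedekind_sum_reciprocity:
  assumes "a > 0" "b > 0" "coprime a b"
  shows "S a b + S b a = - 3 + ((of_int a)\<^sup>2 + (of_int b)\<^sup>2 + 1) / of_int (a * b)"
proof -
  have "dedekind_sum3 a b 1 = dedekind_sum b a"
    using assms by (intro dedekind_sum3_eq) auto
  moreover have "dedekind_sum3 b 1 a = dedekind_sum a b"
    using assms by (subst dedekind_sum3_commute, intro dedekind_sum3_eq) auto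
  moreover have "dedekind_sum3 1 a b = 0"
    by (simp add: dedekind_sum3_def saw_dvd)
  ultimately show ?thesis
    using dedekind_sum3_reciprocity[of a b 1] assms
    by (simp add: normalized_dedekind_sum_def field_simps)
qed

section \<open>Reduction of the modulus\<close>

lemma coprime_square_plus_1: "coprime a (a\<^sup>2 + 1 :: int)"
  by (metis coprime_iff_gcd_eq_1 gcd_add_mult gcd_1_int mult.commute power2_eq_square gcd.commute add.commute)

text \<open>Subtract the three-term law for \<open>a\<close>, \<open>u\<close>, \<open>q\<close>
  from the two-term law for \<open>a\<close> and \<open>q * t\<close>. Both contain
  \<open>S (q * t) a\<close>, because \<open>t\<close> inverts \<open>u\<close> modulo
  \<open>a\<close>, and this term cancels.\<close>

lemma normalized_dedekind_sum_reduction_pos: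
  assumes "a > 0" "q > 0" "t > 0" "t * u = a\<^sup>2 + 1"
    and "coprime a q" "coprime u q" "[a = u * r] (mod q)"
  shows "of_int q * S a (q * t)
    = of_int ((q\<^sup>2 - 1) * a) / of_int u - of_int q * S (a * q) u + of_int q * S r q"
proof -
  have "t * u > 0" using assms by (simp add: add_nonneg_pos)
  with \<open>t > 0\<close> have "u > 0" by (simp add: zero_less_mult_iff)
  have "coprime a t" "coprime a u"
    using coprime_square_plus_1[of a] unfolding assms(4)[symmetric] by simp_all
  have "dedekind_sum3 a u q = dedekind_sum (q * t) a"
  proof -
    have "[u * (q * t) = q * (a\<^sup>2 + 1)] (mod a)"
      using assms(4) by (simp add: mult_ac)
    also have "[q * (a\<^sup>2 + 1) = q] (mod a)"
      by (simp add: cong_iff_dvd_diff algebra_simps power2_eq_square)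
    finally have "[q = u * (q * t)] (mod a)" by (rule cong_sym)
    then show ?thesis
      using \<open>a > 0\<close> \<open>coprime a u\<close>
      by (subst dedekind_sum3_commute) (auto intro!: dedekind_sum3_eq simp: coprime_commute)
  qed
  moreover have "dedekind_sum3 u q a = dedekind_sum (- (a * q)) u"
  proof (rule dedekind_sum3_eq)
    \<comment> \<open>Modulo \<open>u\<close> the square of \<open>a\<close> is -1, so the inverse
      of \<open>a\<close> is -a and q/a becomes -aq.\<close>
    have "q - a * - (a * q) = u * (t * q)"
      using assms(4) by (simp add: algebra_simps power2_eq_square)
    then show "[q = a * - (a * q)] (mod u)"
      by (simp add: cong_iff_dvd_diff)
  qed (use \<open>u > 0\<close> \<open>coprime a u\<close> in auto)
  moreover have "dedekind_sum3 q a u = dedekind_sum r q"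
    using assms by (intro dedekind_sum3_eq) auto
  moreover have "coprime a u" "coprime u q" "coprime q a"
    using assms \<open>coprime a u\<close> by (auto simp: coprime_commute)
  ultimately have three: "S (q * t) a - S (a * q) u + S r q
      = - 3 + ((of_int a)\<^sup>2 + (of_int u)\<^sup>2 + (of_int q)\<^sup>2) / of_int (a * u * q)"
    using dedekind_sum3_reciprocity[of a u q] assms \<open>u > 0\<close>
      normalized_dedekind_sum_minus[of u "a * q"]
    by (simp add: normalized_dedekind_sum_def field_simps)
  have two: "S a (q * t) + S (q * t) a
      = - 3 + ((of_int a)\<^sup>2 + (of_int (q * t))\<^sup>2 + 1) / of_int (a * (q * t))"
    using assms \<open>coprime a t\<close> by (intro normalized_dedekind_sum_reciprocity) auto
  have tu: "of_int t * of_int u = ((of_int a)\<^sup>2 + 1 :: real)"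
    using assms(4) by (metis of_int_1 of_int_add of_int_mult of_int_power)
  \<comment> \<open>Writing t u for a^2 + 1 cancels \<open>t\<close> from the first fraction; over
    the denominator a u q the difference then has numerator (q^2 - 1) a^2.\<close>
  have "((of_int a)\<^sup>2 + (of_int (q * t))\<^sup>2 + 1) / of_int (a * (q * t))
      - ((of_int a)\<^sup>2 + (of_int u)\<^sup>2 + (of_int q)\<^sup>2) / of_int (a * u * q)
      = ((of_int q)\<^sup>2 - 1) * of_int a / (of_int u * of_int q :: real)" (is "?x = ?y")
  proof -
    have "((of_int a)\<^sup>2 + (of_int (q * t))\<^sup>2 + 1) / of_int (a * (q * t))
        = (of_int u + (of_int q)\<^sup>2 * of_int t) / (of_int a * of_int q :: real)"
      using assms tu by (simp add: field_simps power2_eq_square)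
    then have "?x = (of_int u * (of_int u + (of_int q)\<^sup>2 * of_int t)
        - ((of_int a)\<^sup>2 + (of_int u)\<^sup>2 + (of_int q)\<^sup>2)) / (of_int a * of_int u * of_int q)"
      using assms \<open>u > 0\<close> by (simp only:) (simp add: field_simps)
    also have "of_int u * (of_int u + (of_int q)\<^sup>2 * of_int t)
        = (of_int u)\<^sup>2 + (of_int q)\<^sup>2 * ((of_int a)\<^sup>2 + 1 :: real)"
      unfolding tu[symmetric] by (simp add: algebra_simps power2_eq_square)
    also have "((of_int u)\<^sup>2 + (of_int q)\<^sup>2 * ((of_int a)\<^sup>2 + 1)
        - ((of_int a)\<^sup>2 + (of_int u)\<^sup>2 + (of_int q)\<^sup>2)) / (of_int a * of_int u * of_int q) = ?y"
      using assms(1,2) \<open>u > 0\<close> by (simp add: field_simps power2_eq_square)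
    finally show ?thesis .
  qed
  with three two have "S a (q * t) = ?y - S (a * q) u + S r q" by linarith
  then show ?thesis
    using assms \<open>u > 0\<close> by (simp add: field_simps)
qed

text \<open>Both sides are odd under changing the signs of \<open>a\<close> and \<open>r\<close>
  together, which settles negative \<open>a\<close>.\<close>

theorem normalized_dedekind_sum_reduction:
  assumes "a \<noteq> 0" "q > 0" "t > 0" "t * u = a\<^sup>2 + 1"
    and "coprime a q" "coprime u q" "[a = u * r] (mod q)"
  shows "of_int q * S a (q * t)
    = of_int ((q\<^sup>2 - 1) * a) / of_int u - of_int q * S (a * q) u + of_int q * S r q"
proof (cases "a > 0")
  case False
  have "t * u > 0" using assms by (simp add: add_nonneg_pos)
  with \<open>t > 0\<close> have "u > 0" by (simp add: zero_less_mult_iff)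
  have "[- a = u * - r] (mod q)"
    using assms(7) by (metis cong_minus_minus_iff mult_minus_right)
  then have "of_int q * S (- a) (q * t)
    = of_int ((q\<^sup>2 - 1) * - a) / of_int u - of_int q * S (- a * q) u + of_int q * S (- r) q"
    using assms False by (intro normalized_dedekind_sum_reduction_pos) auto
  then show ?thesis
    using assms \<open>u > 0\<close>
    by (simp add: normalized_dedekind_sum_minus)
qed (use assms normalized_dedekind_sum_reduction_pos in blast)

section \<open>Congruences for numerators\<close>

text \<open>For 0 < k < b both sawtooths are linear in residues. Writing a k mod b as a k - b (a k
  div b) leaves a polynomial and one floor sum with coefficient 12; this shows integrality and gives
  the residues modulo 3 and 4.\<close>

lemma modulus_mult_normalized_dedekind_sum:
  assumes "b > 0" "coprime a b"
  shows "of_int b * S a b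
    = of_int (2 * a * (b - 1) * (2 * b - 1) - 3 * b * (b - 1) - 12 * (\<Sum>k\<in>{0..<b}. k * (a * k div b)))"
proof -
  let ?E = "\<Sum>k\<in>{0..<b}. k * (a * k div b)"
  let ?g = "\<lambda>k. (of_int k / of_int b - 1 / 2) * (of_int (a * k mod b) / of_int b - 1 / 2) :: real"
  have "dedekind_sum a b = (\<Sum>k\<in>{1..<b}. saw b k * saw b (a * k))"
    using assms by (simp add: dedekind_sum_eq int_upto_insert0 saw_dvd)
  also have "\<dots> = (\<Sum>k\<in>{1..<b}. ?g k)"
  proof (intro sum.cong refl)
    fix k assume k: "k \<in> {1..<b}"
    then have "\<not> b dvd k" using zdvd_not_zless[of k b] by auto
    moreover from this have "\<not> b dvd a * k"
      using assms by (simp add: coprime_dvd_mult_right_iff coprime_commute)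
    ultimately show "saw b k * saw b (a * k) = ?g k"
      using assms k by (simp add: saw_eq)
  qed
  also have "\<dots> = (\<Sum>k\<in>{0..<b}. ?g k) - 1 / 4"
    using assms by (simp add: int_upto_insert0)
  also have "(\<Sum>k\<in>{0..<b}. ?g k) = (\<Sum>k\<in>{0..<b}. of_int (k * (a * k mod b))) / (of_int b)\<^sup>2
      - (\<Sum>k\<in>{0..<b}. of_int k) / (2 * of_int b) - (\<Sum>k\<in>{0..<b}. of_int (a * k mod b)) / (2 * of_int b)
      + of_int b / 4"
  proof -
    have "?g k = of_int (k * (a * k mod b)) / (of_int b)\<^sup>2 - of_int k / (2 * of_int b)
        - of_int (a * k mod b) / (2 * of_int b) + 1 / 4" for k
      using assms by (simp add: field_simps power2_eq_square)
    then show ?thesis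
      using assms by (simp only: sum.distrib sum_subtractf sum_divide_distrib) simp
  qed
  also have "(\<Sum>k\<in>{0..<b}. of_int (a * k mod b) :: real) = (\<Sum>k\<in>{0..<b}. of_int k)"
  proof -
    have "(\<Sum>k\<in>{0..<b}. of_int ((a * k + 0) mod b) :: real) = (\<Sum>k\<in>{0..<b}. of_int (k mod b))"
      using assms by (intro sum_mod_affine) (auto simp: cong_def)
    then show ?thesis by simp
  qed
  also have "(\<Sum>k\<in>{0..<b}. of_int (k * (a * k mod b)) :: real)
      = of_int a * (\<Sum>k\<in>{0..<b}. (of_int k)\<^sup>2) - of_int b * of_int ?E"
  proof -
    have "k * (a * k mod b) = a * k\<^sup>2 - b * (k * (a * k div b))" for k
      by (simp add: minus_mult_div_eq_mod[symmetric] algebra_simps power2_eq_square)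
    then show ?thesis
      by (simp add: sum_subtractf sum_distrib_left)
  qed
  finally show ?thesis
    using assms by (simp add: normalized_dedekind_sum_def sum_of_int_upto sum_of_int_squares_upto)
      (simp add: field_simps power2_eq_square)
qed

lemma modulus_mult_normalized_dedekind_sum_in_Ints:
  assumes "b > 0" "coprime a b"
  obtains z where "of_int b * S a b = of_int z"
  using modulus_mult_normalized_dedekind_sum[OF assms] that by blast

lemma dvd_3_numerator:
  assumes "b > 0" "coprime a b" "of_int b * S a b = of_int z" "\<not> 3 dvd b"
  shows "3 dvd z"
proof -
  define E where "E = (\<Sum>k\<in>{0..<b}. k * (a * k div b))"
  have "real_of_int z = of_int (2 * a * (b - 1) * (2 * b - 1) - 3 * b * (b - 1) - 12 * E)"
    using modulus_mult_normalized_dedekind_sum[OF assms(1,2)] assms(3) unfolding E_def by simp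
  then have "z = 2 * a * ((b - 1) * (2 * b - 1)) - 3 * b * (b - 1) - 12 * E"
    unfolding of_int_eq_iff by (simp add: algebra_simps)
  moreover have "3 dvd (b - 1) * (2 * b - 1)"
  proof -
    have "3 dvd b - 1 \<or> 3 dvd 2 * b - 1" using assms(4) by presburger
    then show ?thesis by auto
  qed
  moreover have "3 dvd 3 * b * (b - 1)" "3 dvd 12 * E" by simp_all
  ultimately show ?thesis by (simp only: dvd_diff dvd_mult)
qed

lemma cong_4_numerator:
  assumes "b > 0" "coprime a b" "of_int b * S a b = of_int z" "odd b"
  shows "[z = b - 1] (mod 4)"
proof -
  define E where "E = (\<Sum>k\<in>{0..<b}. k * (a * k div b))"
  have "real_of_int z = of_int (2 * a * (b - 1) * (2 * b - 1) - 3 * b * (b - 1) - 12 * E)"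
    using modulus_mult_normalized_dedekind_sum[OF assms(1,2)] assms(3) unfolding E_def by simp
  then have z: "z = 2 * a * (b - 1) * (2 * b - 1) - 3 * b * (b - 1) - 12 * E"
    by (simp only: of_int_eq_iff)
  obtain m where "b = 2 * m + 1" using assms(4) by (rule oddE)
  with z have "z - (b - 1) = 4 * (a * m * (4 * m + 1) - 3 * m * m - 2 * m - 3 * E)"
    by (simp add: algebra_simps)
  then show ?thesis by (simp add: cong_iff_dvd_diff)
qed

lemma numerator_reciprocity:
  assumes "a > 0" "b > 0" "coprime a b" "of_int b * S a b = of_int z" "of_int a * S b a = of_int y"
  shows "a * z + b * y = a\<^sup>2 + b\<^sup>2 + 1 - 3 * a * b"
proof -
  have "of_int (a * b) * (S a b + S b a) = of_int (a * z + b * y)"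
    using assms(4,5) by (simp add: algebra_simps flip: assms(4,5))
  moreover have "of_int (a * b) * (S a b + S b a) = real_of_int (a\<^sup>2 + b\<^sup>2 + 1 - 3 * a * b)"
    using normalized_dedekind_sum_reciprocity[OF assms(1-3)] assms(1,2) by (simp add: field_simps)
  ultimately show ?thesis
    by (simp only: of_int_eq_iff)
qed

text \<open>This is reciprocity with denominators cleared, read modulo \<open>b\<close>.\<close>

lemma cong_modulus_numerator:
  assumes "b > 0" "coprime a b" "of_int b * S a b = of_int z"
  shows "[a * z = a\<^sup>2 + 1] (mod b)"
proof -
  \<comment> \<open>The extra \<open>b\<close> makes the representative positive even if
    \<open>b\<close> divides \<open>a\<close>, as reciprocity demands.\<close>
  define c where "c = a mod b + b"
  have c: "[c = a] (mod b)" by (simp add: c_def cong_def)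
  have "c > 0" using assms by (simp add: c_def add_nonneg_pos)
  have "coprime c b" using c assms(2) by (metis cong_imp_coprime cong_sym)
  have "of_int b * S c b = of_int z"
    using normalized_dedekind_sum_cong[OF assms(1) c] assms(3) by simp
  moreover obtain y where "of_int c * S b c = of_int y"
    using modulus_mult_normalized_dedekind_sum_in_Ints[of c b] \<open>c > 0\<close> \<open>coprime c b\<close>
    by (auto simp: coprime_commute)
  ultimately have "c * z + b * y = c\<^sup>2 + b\<^sup>2 + 1 - 3 * c * b"
    using assms \<open>c > 0\<close> \<open>coprime c b\<close> by (intro numerator_reciprocity)
  then have "c * z - (c\<^sup>2 + 1) = b * (b - 3 * c - y)"
    by (simp add: algebra_simps power2_eq_square)
  then have "[c * z = c\<^sup>2 + 1] (mod b)" by (simp add: cong_iff_dvd_diff)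
  moreover have "[a * z = c * z] (mod b)" "[c\<^sup>2 + 1 = a\<^sup>2 + 1] (mod b)"
    using c by (auto intro!: cong_add cong_pow cong_mult simp: cong_sym)
  ultimately show ?thesis by (metis cong_trans)
qed

section \<open>Numerators modulo 8 for square arguments and square moduli\<close>

lemma even_sum_symmetric:
  fixes F :: "int \<Rightarrow> int"
  assumes "odd a" and sym: "\<And>k. k \<in> {1..<a} \<Longrightarrow> F (a - k) = F k"
  shows "even (\<Sum>k\<in>{1..<a}. F k)"
proof (cases "a > 0")
  case True
  obtain h where a: "a = 2 * h + 1" using assms(1) by (rule oddE)
  have "{1..<a} = {1..h} \<union> {h + 1..<a}" "{1..h} \<inter> {h + 1..<a} = {}" using a True by auto
  then have "(\<Sum>k\<in>{1..<a}. F k) = (\<Sum>k\<in>{1..h}. F k) + (\<Sum>k\<in>{h + 1..<a}. F k)"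
    by (simp only: sum.union_disjoint finite_atLeastAtMost_int finite_atLeastLessThan_int)
  \<comment> \<open>The reflection of k to a - k exchanges the two halves.\<close>
  also have "(\<Sum>k\<in>{h + 1..<a}. F k) = (\<Sum>k\<in>{1..h}. F k)"
    by (rule sum.reindex_bij_witness[where i = "\<lambda>k. a - k" and j = "\<lambda>k. a - k"])
      (use a sym in auto)
  finally show ?thesis by simp
qed simp

lemma odd_square_cong_1_mod_8:
  fixes a :: int
  assumes "odd a"
  shows "[a\<^sup>2 = 1] (mod 8)"
proof -
  obtain m where a: "a = 2 * m + 1" using assms by (rule oddE)
  have "even (m * (m + 1))" by simp
  then obtain j where "m * (m + 1) = 2 * j" by (rule evenE)
  then have "a\<^sup>2 - 1 = 8 * j" unfolding a by (simp add: algebra_simps power2_eq_square)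
  then show ?thesis by (simp add: cong_iff_dvd_diff)
qed

text \<open>Off the multiples of \<open>n\<close> this is 2 n times the sawtooth. At multiples it is
  -n rather than 0, so for odd \<open>n\<close> every value is odd.\<close>

definition odd_saw :: "int \<Rightarrow> int \<Rightarrow> int" where
  "odd_saw n m = 2 * (m mod n) - n"

lemma odd_saw_cong: "[x = y] (mod n) \<Longrightarrow> odd_saw n x = odd_saw n y"
  by (simp add: odd_saw_def cong_def)

lemma odd_saw_minus:
  assumes "n > 0" "\<not> n dvd m"
  shows "odd_saw n (- m) = - odd_saw n m"
  using assms by (auto simp: odd_saw_def zmod_zminus1_eq_if dest: mod_0_imp_dvd)

lemma odd_saw_eq: "n > 0 \<Longrightarrow> \<not> n dvd m \<Longrightarrow> of_int (odd_saw n m) = 2 * of_int n * saw n m"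
  by (simp add: odd_saw_def saw_eq field_simps)

text \<open>Write \<open>w = odd_saw a\<close> and \<open>w(k) w(nk) = 1 - 2 x(k)\<close>. As \<open>w(nk)\<^sup>2 \<equiv> 1\<close> modulo 8,
  \<open>w(k) w(n\<^sup>2k)\<close> is congruent to \<open>(1 - 2 x(k)) (1 - 2 x(nk))\<close>, and the sums over \<open>k\<close> of the functions
  \<open>x(k)\<close> and \<open>x(k) x(nk)\<close> are even, both being invariant under \<open>k \<mapsto> -k\<close>.\<close>
lemma sum_odd_saw_square:
  assumes "a > 0" "odd a" "coprime n a"
  shows "[(\<Sum>k\<in>{1..<a}. odd_saw a k * odd_saw a (n\<^sup>2 * k)) = a - 1] (mod 8)"
proof -
  define w where "w = odd_saw a"
  have w_cong: "w x = w y" if "[x = y] (mod a)" for x y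
    using that by (simp add: w_def odd_saw_cong)
  have "odd (w k)" for k using assms by (simp add: w_def odd_saw_def)
  define x where "x k = (1 - w k * w (n * k)) div 2" for k
  have wx: "w k * w (n * k) = 1 - 2 * x k" for k
    using \<open>\<And>k. odd (w k)\<close> by (simp add: x_def)
  have x_cong: "x k = x l" if "[k = l] (mod a)" for k l
    using w_cong[OF that] w_cong[OF cong_scalar_left[OF that]] by (simp add: x_def)
  have ndvd: "\<not> a dvd k" "\<not> a dvd n * k" if "k \<in> {1..<a}" for k
  proof -
    show "\<not> a dvd k" using that zdvd_not_zless[of k a] by auto
    then show "\<not> a dvd n * k"
      using assms by (simp add: coprime_dvd_mult_right_iff coprime_commute)
  qed
  have x_minus: "x (- k) = x k" if "\<not> a dvd k" for k
  proof -
    have "\<not> a dvd n * k"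
      using that assms by (simp add: coprime_dvd_mult_right_iff coprime_commute)
    then show ?thesis
      using that assms by (simp add: x_def w_def odd_saw_minus)
  qed
  have x_sym: "x (a - k) = x k" "x (n * (a - k)) = x (n * k)" if "k \<in> {1..<a}" for k
  proof -
    have "x (a - k) = x (- k)" by (rule x_cong) (simp add: cong_iff_dvd_diff)
    then show "x (a - k) = x k" using that ndvd x_minus by simp
    have "x (n * (a - k)) = x (- (n * k))"
      by (rule x_cong) (simp add: cong_iff_dvd_diff algebra_simps)
    then show "x (n * (a - k)) = x (n * k)" using that ndvd x_minus by simp
  qed
  have even1: "even (\<Sum>k\<in>{1..<a}. x k)"
    using assms x_sym by (intro even_sum_symmetric) auto
  have even2: "even (\<Sum>k\<in>{1..<a}. x k * x (n * k))"
    using assms x_sym by (intro even_sum_symmetric) auto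
  have perm: "(\<Sum>k\<in>{1..<a}. x (n * k)) = (\<Sum>k\<in>{1..<a}. x k)"
  proof -
    have "(\<Sum>k\<in>{0..<a}. x (n * k + 0)) = (\<Sum>k\<in>{0..<a}. x k)"
      using assms x_cong by (intro sum_mod_affine)
    then show ?thesis using assms by (simp add: int_upto_insert0)
  qed
  have "[w k * w (n\<^sup>2 * k) = 1 - 2 * x k - 2 * x (n * k) + 4 * (x k * x (n * k))] (mod 8)" for k
  proof -
    have "[(w (n * k))\<^sup>2 * (w k * w (n\<^sup>2 * k)) = 1 * (w k * w (n\<^sup>2 * k))] (mod 8)"
      using odd_square_cong_1_mod_8 \<open>\<And>k. odd (w k)\<close> by (intro cong_mult cong_refl) auto
    moreover have "(w (n * k))\<^sup>2 * (w k * w (n\<^sup>2 * k)) = (1 - 2 * x k) * (1 - 2 * x (n * k))"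
      unfolding wx[symmetric] by (simp add: power2_eq_square mult_ac)
    moreover have "\<dots> = 1 - 2 * x k - 2 * x (n * k) + 4 * (x k * x (n * k))"
      by (simp add: algebra_simps)
    ultimately show ?thesis by (simp add: cong_sym_eq)
  qed
  then have "[(\<Sum>k\<in>{1..<a}. w k * w (n\<^sup>2 * k))
      = (\<Sum>k\<in>{1..<a}. 1 - 2 * x k - 2 * x (n * k) + 4 * (x k * x (n * k)))] (mod 8)"
    by (intro cong_sum)
  also have "(\<Sum>k\<in>{1..<a}. 1 - 2 * x k - 2 * x (n * k) + 4 * (x k * x (n * k)))
      = (a - 1) - 4 * (\<Sum>k\<in>{1..<a}. x k) + 4 * (\<Sum>k\<in>{1..<a}. x k * x (n * k))"
    using assms by (simp add: sum.distrib sum_subtractf perm flip: sum_distrib_left)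
  also have "[\<dots> = a - 1] (mod 8)"
    using even1 even2 by (elim evenE) (simp add: cong_iff_dvd_diff)
  finally show ?thesis by (simp add: w_def)
qed

text \<open>Scaling each sawtooth by 2 a shows that a y is three times the sum of
  \<open>odd_saw\<close> products, hence 3(a - 1) modulo 8. Multiplying by \<open>a\<close>, whose
  square is 1, gives y = 3(1 - a), which differs from a - 1 by a multiple of 8 since
  \<open>a\<close> is odd.\<close>

lemma cong_8_numerator_square_top:
  assumes "a > 0" "odd a" "coprime n a" "of_int a * S (n\<^sup>2) a = of_int y"
  shows "[y = a - 1] (mod 8)"
proof -
  have ndvd: "\<not> a dvd k" "\<not> a dvd n\<^sup>2 * k" if "k \<in> {1..<a}" for k
  proof -
    show "\<not> a dvd k" using that zdvd_not_zless[of k a] by auto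
    then show "\<not> a dvd n\<^sup>2 * k"
      using assms by (simp add: coprime_dvd_mult_right_iff coprime_commute)
  qed
  have "S (n\<^sup>2) a = 12 * (\<Sum>k\<in>{1..<a}. saw a k * saw a (n\<^sup>2 * k))"
    using assms by (simp add: normalized_dedekind_sum_def dedekind_sum_eq int_upto_insert0 saw_dvd)
  then have "of_int a * (of_int a * S (n\<^sup>2) a)
      = (\<Sum>k\<in>{1..<a}. 3 * ((2 * of_int a * saw a k) * (2 * of_int a * saw a (n\<^sup>2 * k))))"
    by (simp add: sum_distrib_left mult_ac)
  also have "\<dots> = (\<Sum>k\<in>{1..<a}. 3 * (of_int (odd_saw a k) * of_int (odd_saw a (n\<^sup>2 * k))))"
    using assms(1) ndvd by (intro sum.cong refl) (simp only: odd_saw_eq simp_thms)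
  finally have "real_of_int (a * y) = of_int (3 * (\<Sum>k\<in>{1..<a}. odd_saw a k * odd_saw a (n\<^sup>2 * k)))"
    using assms(4) by (simp add: sum_distrib_left)
  then have "a * y = 3 * (\<Sum>k\<in>{1..<a}. odd_saw a k * odd_saw a (n\<^sup>2 * k))"
    by (simp only: of_int_eq_iff)
  then have "[a * y = 3 * (a - 1)] (mod 8)"
    using cong_scalar_left[OF sum_odd_saw_square[OF assms(1-3)], of 3] by simp
  then obtain i where i: "a * y - 3 * (a - 1) = 8 * i"
    by (auto simp: cong_iff_dvd_diff)
  obtain j where j: "a\<^sup>2 - 1 = 8 * j"
    using odd_square_cong_1_mod_8[OF assms(2)] by (auto simp: cong_iff_dvd_diff)
  obtain m where m: "a = 2 * m + 1" using assms(2) by (rule oddE)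
  have "a * y = 3 * (a - 1) + 8 * i" using i by simp
  then have "a\<^sup>2 * y = a * (3 * (a - 1) + 8 * i)" by (simp only: power2_eq_square mult.assoc)
  then have "a\<^sup>2 * y = 3 * (a\<^sup>2 - a) + 8 * (a * i)" by (simp add: power2_eq_square algebra_simps)
  moreover have "a\<^sup>2 = 1 + 8 * j" using j by simp
  ultimately have "y - (a - 1) = 8 * (3 * j + a * i - j * y - m)"
    using m by (simp add: algebra_simps)
  then show ?thesis by (simp add: cong_iff_dvd_diff)
qed

text \<open>Reciprocity moves the square from the modulus to the first argument, where the residue
  is known. With b = c^2 = 1 and y = c - 1 modulo 8 it yields c z = 4 - 4 c = 0.\<close>

lemma dvd_8_numerator_square_modulus:
  assumes "n > 0" "odd n" "coprime a n" "of_int (n\<^sup>2) * S a (n\<^sup>2) = of_int z"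
  shows "8 dvd z"
proof -
  define b where "b = n\<^sup>2"
  have "b > 0" "odd b" using assms by (auto simp: b_def)
  \<comment> \<open>The representative must be positive and odd; as \<open>b\<close> is odd, adding
    it once or twice adjusts the parity.\<close>
  define c where "c = a mod b + (if odd (a mod b) then 2 * b else b)"
  have c: "[c = a] (mod b)" by (simp add: c_def cong_def)
  have "c > 0" using \<open>b > 0\<close> by (simp add: c_def add_nonneg_pos)
  have "odd c" using \<open>odd b\<close> by (simp add: c_def)
  have "coprime a b" using assms(3) by (simp add: b_def)
  then have "coprime c b" using c by (metis cong_imp_coprime cong_sym)
  then have "coprime n c" by (simp add: b_def coprime_commute)
  have z: "of_int b * S c b = of_int z"
    using normalized_dedekind_sum_cong[OF \<open>b > 0\<close> c] assms(4) by (simp add: b_def)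
  obtain y where y: "of_int c * S b c = of_int y"
    using modulus_mult_normalized_dedekind_sum_in_Ints[of c b] \<open>c > 0\<close> \<open>coprime c b\<close>
    by (auto simp: coprime_commute)
  have "[y = c - 1] (mod 8)"
    using y \<open>c > 0\<close> \<open>odd c\<close> \<open>coprime n c\<close> unfolding b_def by (intro cong_8_numerator_square_top)
  then obtain i where i: "y = c - 1 + 8 * i"
    by (metis cong_iff_lin cong_sym mult.commute)
  have rec: "c * z + b * y = c\<^sup>2 + b\<^sup>2 + 1 - 3 * c * b"
    using \<open>c > 0\<close> \<open>b > 0\<close> \<open>coprime c b\<close> z y by (rule numerator_reciprocity)
  have "[b = 1] (mod 8)" unfolding b_def using assms(2) by (rule odd_square_cong_1_mod_8)
  then obtain l where l: "b = 1 + 8 * l"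
    by (metis cong_iff_lin cong_sym mult.commute)
  obtain j where j: "c\<^sup>2 = 1 + 8 * j"
    using odd_square_cong_1_mod_8[OF \<open>odd c\<close>] by (metis cong_iff_lin cong_sym mult.commute)
  obtain m where m: "c = 2 * m + 1" using \<open>odd c\<close> by (rule oddE)
  \<comment> \<open>\<open>8 * K\<close> is what remains for c z in reciprocity after all
    substitutions; the constant part 4 - 4 c equals -8 m.\<close>
  define K where "K = j + 2 * l + 8 * l\<^sup>2 - 3 * c * l - b * i - l * (c - 1) - m"
  have "c * z = 8 * K"
    using rec unfolding i j unfolding K_def l using m by (simp add: algebra_simps power2_eq_square)
  then have "c\<^sup>2 * z = 8 * (c * K)" by (simp add: power2_eq_square)
  then have "z = 8 * (c * K - j * z)"
    unfolding j by (simp add: algebra_simps)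
  then show ?thesis by (metis dvd_triv_left)
qed

section \<open>Numerators and the sets Lambda and Gamma\<close>

lemma gcd_residue_class:
  fixes m g x :: int
  assumes "m > 0" "gcd g m dvd x"
  shows "\<exists>s\<in>carrier (residue_ring m). [x = g * s] (mod m)"
proof -
  obtain j where "x = gcd g m * j" using assms(2) by (rule dvdE)
  moreover obtain u v where "u * g + v * m = gcd g m" using bezout_int[of g m] by blast
  ultimately have "x = (u * g + v * m) * j" by simp
  then have "x = g * (u * j) + m * (v * j)" by (simp add: algebra_simps)
  then have "[x = g * (u * j)] (mod m)" by (simp add: cong_iff_dvd_diff)
  also have "[g * (u * j) = g * ((u * j) mod m)] (mod m)"
    by (intro cong_scalar_left) (simp add: cong_def)
  finally show ?thesis
    using assms(1) by (intro bexI[of _ "(u * j) mod m"]) (auto simp: residue_ring_def)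
qed

text \<open>Modulo \<open>m\<close>, the numbers \<open>g\<close> and \<open>gcd g m\<close>
  generate the same ideal; Bezout gives the nontrivial inclusion.\<close>

lemma multiple_mod_residues_iff:
  fixes m g x :: int
  assumes "m > 0"
  shows "x mod m \<in> {(g * s) mod m | s. s \<in> carrier (residue_ring m)} \<longleftrightarrow> gcd g m dvd x"
proof
  assume "x mod m \<in> {(g * s) mod m | s. s \<in> carrier (residue_ring m)}"
  then obtain s where "x mod m = (g * s) mod m" by blast
  then have "m dvd x - g * s" by (simp add: mod_eq_dvd_iff)
  then have "gcd g m dvd x - g * s" "gcd g m dvd g * s" by (auto intro: dvd_trans)
  then show "gcd g m dvd x" using dvd_add[of "gcd g m" "x - g * s" "g * s"] by simp
next
  assume "gcd g m dvd x"
  then obtain s where "s \<in> carrier (residue_ring m)" "x mod m = (g * s) mod m"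
    using gcd_residue_class[OF assms] unfolding cong_def by blast
  then show "x mod m \<in> {(g * s) mod m | s. s \<in> carrier (residue_ring m)}" by blast
qed

lemma mod_mem_Gamma_set_iff:
  assumes "q \<ge> 2"
  shows "x mod (q\<^sup>2 - 1) \<in> Gamma_set q \<longleftrightarrow> gcd (if is_square q then 24 else 12) (q\<^sup>2 - 1) dvd x"
proof -
  have "q\<^sup>2 - 1 > 0" using assms power2_less_imp_less[of 1 q] by auto
  then show ?thesis
    by (cases "is_square q") (simp_all only: Gamma_set_def if_True if_False multiple_mod_residues_iff)
qed

text \<open>Separates the conditions at 3 and at 2. The gcds with \<open>a\<close> and with
  \<open>b\<close> are coprime, so their product divides \<open>x\<close> once both do.\<close>

lemma gcd_mult_dvd_iff:
  fixes a b m x :: int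
  assumes "coprime a b"
  shows "gcd (a * b) m dvd x \<longleftrightarrow> gcd a m dvd x \<and> gcd b m dvd x"
proof
  assume "gcd (a * b) m dvd x"
  moreover have "gcd a m dvd gcd (a * b) m" "gcd b m dvd gcd (a * b) m"
    by (auto intro: dvd_trans[OF gcd_dvd1])
  ultimately show "gcd a m dvd x \<and> gcd b m dvd x" by (blast intro: dvd_trans)
next
  assume "gcd a m dvd x \<and> gcd b m dvd x"
  moreover have "coprime (gcd a m) (gcd b m)"
    using assms by (rule coprime_divisors[OF gcd_dvd1 gcd_dvd1])
  ultimately have "gcd a m * gcd b m dvd x" by (blast intro: divides_mult)
  moreover have "gcd (a * b) m dvd gcd a m * gcd b m"
  proof -
    obtain u v where 1: "u * a + v * m = gcd a m" using bezout_int[of a m] by blast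
    obtain u' v' where 2: "u' * b + v' * m = gcd b m" using bezout_int[of b m] by blast
    \<comment> \<open>In the product of the Bezout identities, every term other than the one in
      \<open>a * b\<close> carries the factor \<open>m\<close>.\<close>
    have "gcd a m * gcd b m = u * u' * (a * b) + (u * a * v' + v * (u' * b) + v * v' * m) * m"
      unfolding 1[symmetric] 2[symmetric] by (simp add: algebra_simps)
    then show ?thesis by (simp only: dvd_add dvd_mult gcd_dvd1 gcd_dvd2)
  qed
  ultimately show "gcd (a * b) m dvd x" by (rule dvd_trans[rotated])
qed

text \<open>q^2 - 1 is divisible by 3 if \<open>q\<close> is not and prime to 3 otherwise; it is
  divisible by 8 for odd \<open>q\<close> and odd for even \<open>q\<close>. So the gcd keeps or
  loses each of the factors 3 and \<open>e\<close> as a whole.\<close>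

lemma gcd_square_minus_1_dvd_iff:
  fixes q x e :: int
  assumes "e = 4 \<or> e = 8"
  shows "gcd (3 * e) (q\<^sup>2 - 1) dvd x \<longleftrightarrow> (\<not> 3 dvd q \<longrightarrow> 3 dvd x) \<and> (odd q \<longrightarrow> e dvd x)"
proof -
  have e: "e dvd 2 ^ 3" using assms by auto
  have "coprime 3 (2 :: int)" by (simp add: coprime_right_2_iff_odd)
  then have "coprime 3 (2 ^ 3 :: int)" by (rule coprime_power_right_iff[THEN iffD2, OF disjI1])
  then have "coprime 3 e" by (rule coprime_divisors[OF dvd_refl e])
  have three: "gcd 3 (q\<^sup>2 - 1) = (if 3 dvd q then 1 else 3)"
  proof (cases "3 dvd q")
    case True
    then have "3 dvd q\<^sup>2" by (simp add: power2_eq_square)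
    then have "coprime 3 (q\<^sup>2 - 1)"
      by (rule coprime_divisors[OF _ dvd_refl coprime_doff_one_right])
    then show ?thesis using True by simp
  next
    case False
    have "(q - 1) * (q + 1) = q\<^sup>2 - 1" by (simp add: algebra_simps power2_eq_square)
    moreover have "3 dvd q - 1 \<or> 3 dvd q + 1" using False by presburger
    ultimately have "3 dvd q\<^sup>2 - 1" by (auto simp flip: \<open>(q - 1) * (q + 1) = q\<^sup>2 - 1\<close>)
    then show ?thesis using False by (simp add: gcd_proj1_iff)
  qed
  have two: "gcd e (q\<^sup>2 - 1) = (if odd q then e else 1)"
  proof (cases "odd q")
    case True
    then have "8 dvd q\<^sup>2 - 1" using odd_square_cong_1_mod_8 by (simp add: cong_iff_dvd_diff)
    moreover have "e dvd 8" using assms by auto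
    ultimately have "e dvd q\<^sup>2 - 1" by (rule dvd_trans[rotated])
    then show ?thesis using True assms by (auto simp: gcd_proj1_iff)
  next
    case False
    then have "coprime 2 (q\<^sup>2 - 1)" by simp
    then have "coprime (2 ^ 3) (q\<^sup>2 - 1)" by (rule coprime_power_left_iff[THEN iffD2, OF disjI1])
    then have "coprime e (q\<^sup>2 - 1)" by (rule coprime_divisors[OF e dvd_refl])
    then show ?thesis using False by simp
  qed
  show ?thesis
    unfolding gcd_mult_dvd_iff[OF \<open>coprime 3 e\<close>] three two by simp
qed

lemma numerator_residue:
  assumes "q > 0" "coprime r q" "of_int q * S r q = of_int z"
  shows "(\<not> 3 dvd q \<longrightarrow> 3 dvd z)" "odd q \<Longrightarrow> [z = q - 1] (mod 4)"
    "odd q \<Longrightarrow> is_square q \<Longrightarrow> 8 dvd z"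
proof -
  show "\<not> 3 dvd q \<longrightarrow> 3 dvd z" using dvd_3_numerator[OF assms] by blast
  show "odd q \<Longrightarrow> [z = q - 1] (mod 4)" by (rule cong_4_numerator[OF assms])
  assume q: "odd q" "is_square q"
  from q(2) obtain n where n: "q = n\<^sup>2" by (rule is_nth_powerE)
  then have "\<bar>n\<bar>\<^sup>2 = q" by simp
  moreover have "\<bar>n\<bar> > 0" using assms(1) n by auto
  moreover have "odd \<bar>n\<bar>" using q(1) n by simp
  moreover have "coprime r \<bar>n\<bar>" using assms(2) n by simp
  ultimately show "8 dvd z"
    using assms(3) dvd_8_numerator_square_modulus[of "\<bar>n\<bar>" r z] by simp
qed

section \<open>Passing between values k/q and elements of Lambda\<close>

lemma Lambda_set_memI:
  assumes "t > 0" "t dvd a\<^sup>2 + 1" "coprime (a * q) t"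
    "of_int n = of_int ((q\<^sup>2 - 1) * a) / of_int t - of_int q * S (a * q) t"
  shows "n mod (q\<^sup>2 - 1) \<in> Lambda_set q"
  unfolding Lambda_set_def
  by (intro CollectI exI[of _ n] exI[of _ a] exI[of _ t] conjI refl assms)

text \<open>The representative \<open>a\<close> of its residue class modulo \<open>t\<close> is at our disposal, and replacing \<open>a\<close>
  by \<open>a + t m\<close> adds \<open>(q\<^sup>2 - 1) m\<close>. So an element of \<open>Lambda_set q\<close> can be lifted to any integer in
  its residue class.\<close>
lemma Lambda_set_memE:
  assumes "n mod (q\<^sup>2 - 1) \<in> Lambda_set q"
  obtains a t where "t > 0" "t dvd a\<^sup>2 + 1" "coprime (a * q) t"
    "of_int n = of_int ((q\<^sup>2 - 1) * a) / of_int t - of_int q * S (a * q) t"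
proof -
  obtain n' a t where at: "n mod (q\<^sup>2 - 1) = n' mod (q\<^sup>2 - 1)" "t > 0" "t dvd a\<^sup>2 + 1"
    "coprime (a * q) t" "of_int n' = of_int ((q\<^sup>2 - 1) * a) / of_int t - of_int q * S (a * q) t"
    using assms unfolding Lambda_set_def by blast
  then obtain m where m: "n = n' + (q\<^sup>2 - 1) * m"
    by (metis dvdE mod_eq_dvd_iff diff_add_cancel add.commute)
  define c where "c = a + t * m"
  have c: "[c = a] (mod t)" by (simp add: c_def cong_def)
  have "[c\<^sup>2 + 1 = a\<^sup>2 + 1] (mod t)" "[c * q = a * q] (mod t)"
    using c by (auto intro: cong_add cong_pow cong_scalar_right)
  then have "t dvd c\<^sup>2 + 1" "coprime (c * q) t" "S (c * q) t = S (a * q) t"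
    using at cong_dvd_iff[of "c\<^sup>2 + 1" "a\<^sup>2 + 1" t] cong_imp_coprime[of "a * q" "c * q" t]
      normalized_dedekind_sum_cong[of t "c * q" "a * q"] by (auto simp: cong_sym)
  moreover from this have "of_int n = of_int ((q\<^sup>2 - 1) * c) / of_int t - of_int q * S (c * q) t"
    using at(2,5) unfolding m c_def by (simp add: field_simps)
  ultimately show thesis using that at(2) by blast
qed

text \<open>The reduction formula run backwards: the lifted element supplies \<open>a\<close> and
  \<open>u\<close>, and \<open>t\<close> is the cofactor of \<open>u\<close> in a^2 + 1. The main
  point is that a = u r modulo \<open>q\<close> holds automatically.\<close>

lemma Lambda_set_imp_value:
  assumes "q \<ge> 2" "coprime k q" "[k * r = 1] (mod q)" "of_int q * S r q = of_int z"
    and "(k - z) mod (q\<^sup>2 - 1) \<in> Lambda_set q"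
  shows "\<exists>a b. b \<ge> 1 \<and> coprime a b \<and> S a b = of_int k / of_int q"
proof -
  have "coprime r q" using assms(3) by (metis coprime_iff_invertible_int mult.commute)
  obtain a u where au: "u > 0" "u dvd a\<^sup>2 + 1" "coprime (a * q) u"
    "of_int (k - z) = of_int ((q\<^sup>2 - 1) * a) / of_int u - of_int q * S (a * q) u"
    using assms(5) by (rule Lambda_set_memE)
  obtain y where y: "of_int u * S (a * q) u = of_int y"
    using modulus_mult_normalized_dedekind_sum_in_Ints au by blast
  have "real_of_int (u * (k - z)) = of_int ((q\<^sup>2 - 1) * a - q * y)"
    using au(1,4) by (simp add: field_simps flip: y)
  then have uk: "u * (k - z) = (q\<^sup>2 - 1) * a - q * y" by (simp only: of_int_eq_iff)
  \<comment> \<open>Together with k r = 1, the numerator congruence determines z as k + r modulo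
    \<open>q\<close>.\<close>
  have "[r * z = r\<^sup>2 + 1] (mod q)"
    using assms(1,4) \<open>coprime r q\<close> by (intro cong_modulus_numerator) auto
  also have "[r\<^sup>2 + 1 = r\<^sup>2 + k * r] (mod q)"
    using assms(3) by (intro cong_add cong_refl) (rule cong_sym)
  also have "r\<^sup>2 + k * r = r * (k + r)" by (simp add: algebra_simps power2_eq_square)
  finally have "[z = k + r] (mod q)"
    using \<open>coprime r q\<close> by (simp add: cong_mult_lcancel)
  then have "[u * z = u * (k + r)] (mod q)" by (rule cong_scalar_left)
  \<comment> \<open>Modulo \<open>q\<close> the identity \<open>uk\<close> reads u (k - z) = -a, so
    that a = u (z - k) = u r.\<close>
  moreover have "a - u * r = u * z - u * (k + r) + q * (q * a - y)"
    using uk by (simp add: algebra_simps power2_eq_square)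
  ultimately have "[a = u * r] (mod q)"
    by (simp add: cong_iff_dvd_diff)
  moreover have "coprime u q" "coprime a u" using au(3) by (auto simp: coprime_commute)
  ultimately have "coprime a q"
    using \<open>coprime r q\<close> by (metis cong_imp_coprime cong_sym coprime_mult_left_iff)
  then have "a \<noteq> 0" using assms(1) by auto
  obtain t where t: "u * t = a\<^sup>2 + 1" using au(2) by (metis dvdE)
  have "u * t > 0" unfolding t by (simp add: add_nonneg_pos)
  then have "t > 0" using au(1) by (simp add: zero_less_mult_iff)
  have "of_int q * S a (q * t)
    = of_int ((q\<^sup>2 - 1) * a) / of_int u - of_int q * S (a * q) u + of_int q * S r q"
    using \<open>a \<noteq> 0\<close> \<open>t > 0\<close> t assms(1) \<open>coprime a q\<close> \<open>coprime u q\<close> \<open>[a = u * r] (mod q)\<close>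
    by (intro normalized_dedekind_sum_reduction) (auto simp: mult.commute)
  also have "\<dots> = of_int k"
    using assms(4) au(4) by simp
  finally have "S a (q * t) = of_int k / of_int q"
    using assms(1) by (simp add: field_simps)
  moreover have "coprime a (q * t)"
  proof -
    have "coprime a t" using coprime_square_plus_1[of a] unfolding t[symmetric] by simp
    with \<open>coprime a q\<close> show ?thesis by simp
  qed
  moreover have "q * t \<ge> 1" using assms(1) \<open>t > 0\<close> by (simp add: int_one_le_iff_zero_less)
  ultimately show ?thesis by blast
qed

text \<open>Integrality of b S(a, b) forces b = q t. The numerator congruence modulo q t shows that
  \<open>t\<close> divides a^2 + 1 and that the cofactor \<open>u\<close> is a k modulo
  \<open>q\<close>, hence a unit, so the reduction formula applies with r = a/u.\<close>

lemma value_imp_Lambda_set: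
  assumes "q \<ge> 2" "coprime k q" "b \<ge> 1" "coprime a b" "S a b = of_int k / of_int q"
  obtains r z where "coprime r q" "of_int q * S r q = of_int z" "(k - z) mod (q\<^sup>2 - 1) \<in> Lambda_set q"
proof -
  obtain w where w: "of_int b * S a b = of_int w"
    using modulus_mult_normalized_dedekind_sum_in_Ints[of b a] assms by auto
  then have "real_of_int (b * k) = of_int (q * w)"
    using assms(1,5) by (simp add: field_simps)
  then have bk: "b * k = q * w" by (simp only: of_int_eq_iff)
  then have "q dvd b * k" by simp
  then have "q dvd b" using assms(2) by (simp add: coprime_dvd_mult_left_iff coprime_commute)
  then obtain t where b: "b = q * t" by (rule dvdE)
  have "t > 0" using assms(1,3) b by (metis int_one_le_iff_zero_less zero_less_mult_pos order_less_le_trans zero_less_numeral)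
  have "w = t * k" using bk b assms(1) by simp
  have "[a * w = a\<^sup>2 + 1] (mod b)"
    using assms w by (intro cong_modulus_numerator) auto
  then have cong: "[a * (t * k) = a\<^sup>2 + 1] (mod q * t)" using \<open>w = t * k\<close> b by simp
  then have "[a * (t * k) = a\<^sup>2 + 1] (mod t)" by (metis cong_modulus_mult mult.commute)
  then have "t dvd a\<^sup>2 + 1" by (metis cong_dvd_iff dvd_mult dvd_mult2 dvd_refl)
  then obtain u where u: "t * u = a\<^sup>2 + 1" by (metis dvdE)
  have "t * u > 0" unfolding u by (simp add: add_nonneg_pos)
  then have "u > 0" using \<open>t > 0\<close> by (simp add: zero_less_mult_iff)
  have "q * t dvd a * (t * k) - t * u"
    using cong unfolding u by (simp add: cong_iff_dvd_diff)
  moreover have "a * (t * k) - t * u = (a * k - u) * t" by (simp add: algebra_simps)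
  ultimately have "q dvd a * k - u" using \<open>t > 0\<close> by simp
  then have "[a * k = u] (mod q)" by (simp add: cong_iff_dvd_diff)
  moreover have "coprime a q" using assms(4) b by simp
  ultimately have "coprime u q" using assms(2) by (metis cong_imp_coprime coprime_mult_left_iff)
  then obtain v where "[u * v = 1] (mod q)" by (metis coprime_iff_invertible_int)
  then have r: "[a = u * (v * a)] (mod q)"
    using cong_scalar_right[of "u * v" 1 q a] by (simp add: cong_sym_eq mult.assoc)
  define r where "r = v * a"
  have "coprime r q"
    using r \<open>coprime a q\<close> unfolding r_def[symmetric] by (metis cong_imp_coprime coprime_mult_left_iff)
  obtain z where z: "of_int q * S r q = of_int z"
    using modulus_mult_normalized_dedekind_sum_in_Ints[of q r] \<open>coprime r q\<close> assms(1) by auto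
  have "a \<noteq> 0" using \<open>coprime a q\<close> assms(1) by auto
  have "of_int q * S a (q * t)
    = of_int ((q\<^sup>2 - 1) * a) / of_int u - of_int q * S (a * q) u + of_int q * S r q"
    using \<open>a \<noteq> 0\<close> assms(1) \<open>t > 0\<close> u \<open>coprime a q\<close> \<open>coprime u q\<close> r unfolding r_def
    by (intro normalized_dedekind_sum_reduction) auto
  moreover have "of_int q * S a (q * t) = of_int k"
    using assms(1,5) b by simp
  ultimately have "of_int (k - z) = of_int ((q\<^sup>2 - 1) * a) / of_int u - of_int q * S (a * q) u"
    using z by simp
  moreover have "coprime (a * q) u"
  proof -
    have "coprime a u" using coprime_square_plus_1[of a] unfolding u[symmetric] by simp
    with \<open>coprime u q\<close> show ?thesis by (simp add: coprime_commute)
  qed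
  moreover have "u dvd a\<^sup>2 + 1" using u by (metis dvd_triv_right)
  ultimately have "(k - z) mod (q\<^sup>2 - 1) \<in> Lambda_set q"
    using \<open>u > 0\<close> by (intro Lambda_set_memI)
  with \<open>coprime r q\<close> z show thesis by (rule that)
qed

text \<open>The relevant residues of \<open>z\<close> depend only on \<open>q\<close>, so the
  condition on k - z becomes one on \<open>k\<close> in which \<open>r\<close> no longer
  occurs.\<close>

lemma numerator_condition_iff:
  assumes "q \<ge> 2" "coprime r q" "of_int q * S r q = of_int z"
  shows "(k - z) mod (q\<^sup>2 - 1) \<in> Gamma_set q \<longleftrightarrow>
     ((\<not> 3 dvd q \<longrightarrow> 3 dvd k) \<and>
      (\<not> 2 dvd q \<longrightarrow>
         ([q = 3] (mod 4) \<longrightarrow> [k = 2] (mod 4)) \<and>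
         (is_square q \<longrightarrow> [k = 0] (mod 8)) \<and>
         (\<not> [q = 3] (mod 4) \<and> \<not> is_square q \<longrightarrow> [k = 0] (mod 4))))"
proof -
  define e :: int where "e = (if is_square q then 8 else 4)"
  have "(if is_square q then 24 else 12) = 3 * e" by (simp add: e_def)
  then have "(k - z) mod (q\<^sup>2 - 1) \<in> Gamma_set q \<longleftrightarrow>
      (\<not> 3 dvd q \<longrightarrow> 3 dvd k - z) \<and> (odd q \<longrightarrow> e dvd k - z)"
    using mod_mem_Gamma_set_iff[OF assms(1)] gcd_square_minus_1_dvd_iff[of e] by (simp add: e_def)
  moreover have "\<not> 3 dvd q \<Longrightarrow> 3 dvd k - z \<longleftrightarrow> 3 dvd k"
    using numerator_residue(1)[OF _ assms(2,3)] assms(1) by (simp add: dvd_diff_left_iff)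
  moreover have "e dvd k - z \<longleftrightarrow>
         ([q = 3] (mod 4) \<longrightarrow> [k = 2] (mod 4)) \<and>
         (is_square q \<longrightarrow> [k = 0] (mod 8)) \<and>
         (\<not> [q = 3] (mod 4) \<and> \<not> is_square q \<longrightarrow> [k = 0] (mod 4))" if "odd q"
  proof (cases "is_square q")
    case True
    then obtain n where n: "q = n\<^sup>2" by (rule is_nth_powerE)
    \<comment> \<open>An odd square is 1 modulo 8, so the clause for q = 3 modulo 4 is vacuous
      here.\<close>
    then have "[q = 1] (mod 8)" using that odd_square_cong_1_mod_8[of n] by simp
    then have "q mod 4 \<noteq> 3" unfolding cong_def by presburger
    moreover have "8 dvd z" using numerator_residue(3)[OF _ assms(2,3) that True] assms(1) by simp
    ultimately show ?thesis
      using True by (simp add: e_def cong_def dvd_diff_left_iff) presburger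
  next
    case False
    have "[z = q - 1] (mod 4)" using numerator_residue(2)[OF _ assms(2,3) that] assms(1) by simp
    then have "4 dvd k - z \<longleftrightarrow> 4 dvd k - (q - 1)"
      unfolding cong_def by presburger
    \<comment> \<open>For odd \<open>q\<close>, q - 1 is 2 modulo 4 if \<open>q\<close> is 3 modulo
      4, and 0 otherwise.\<close>
    also have "\<dots> \<longleftrightarrow> (q mod 4 = 3 \<longrightarrow> k mod 4 = 2) \<and> (q mod 4 \<noteq> 3 \<longrightarrow> k mod 4 = 0)"
      using that by presburger
    finally show ?thesis using False by (simp add: e_def cong_def)
  qed
  ultimately show ?thesis by blast
qed

theorem theorem3p11:
  fixes q :: int
  assumes "q \<ge> 2"
    and "Lambda_set q = Gamma_set q"
  shows "\<forall>k::int. coprime k q \<longrightarrow>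
    ((\<exists>a b::int. b \<ge> 1 \<and> coprime a b \<and>
        normalized_dedekind_sum a b = of_int k / of_int q)
     \<longleftrightarrow>
     ((\<not> 3 dvd q \<longrightarrow> 3 dvd k) \<and>
      (\<not> 2 dvd q \<longrightarrow>
         ([q = 3] (mod 4) \<longrightarrow> [k = 2] (mod 4)) \<and>
         (is_square q \<longrightarrow> [k = 0] (mod 8)) \<and>
         (\<not> [q = 3] (mod 4) \<and> \<not> is_square q \<longrightarrow> [k = 0] (mod 4)))))"
    (is "\<forall>k. _ \<longrightarrow> (?V k \<longleftrightarrow> ?C k)")
proof (intro allI impI iffI)
  fix k assume k: "coprime k q" "?V k"
  then obtain a b where "b \<ge> 1" "coprime a b" "S a b = of_int k / of_int q" by blast
  \<comment> \<open>Any unit \<open>r\<close> will do in this direction, since the criterion for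
    \<open>k\<close> is the same for all of them.\<close>
  with assms(1) k(1) obtain r z where "coprime r q" "of_int q * S r q = of_int z"
    "(k - z) mod (q\<^sup>2 - 1) \<in> Lambda_set q"
    by (rule value_imp_Lambda_set)
  then show "?C k"
    unfolding assms(2) using numerator_condition_iff[OF assms(1)] by blast
next
  fix k assume k: "coprime k q" "?C k"
  \<comment> \<open>Realizing k/q, by contrast, requires the inverse of \<open>k\<close> modulo
    \<open>q\<close>.\<close>
  obtain r where r: "[k * r = 1] (mod q)"
    using k(1) by (metis coprime_iff_invertible_int)
  then have "coprime r q" by (metis coprime_iff_invertible_int mult.commute)
  obtain z where z: "of_int q * S r q = of_int z"
    using modulus_mult_normalized_dedekind_sum_in_Ints[of q r] \<open>coprime r q\<close> assms(1) by auto
  then have "(k - z) mod (q\<^sup>2 - 1) \<in> Lambda_set q"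
    unfolding assms(2) using numerator_condition_iff[OF assms(1) \<open>coprime r q\<close> z] k(2) by blast
  with assms(1) k(1) r z show "?V k" by (rule Lambda_set_imp_value)
qed

end
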